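(* Let $F$ be a forest with no isolated vertices. Then $$\frac14\big(|\mathit{Deg}_{\ge2}(F)|+|\mathit{Supp}(F)|\big)\le\gamma(F)\le\frac12\big(|\mathit{Deg}_{\ge2}(F)|+|\mathit{Supp}(F)|\big).$$
   Context: $\gamma(F)$ is the domination number (size of a minimum dominating set) of $F$. $\mathit{Deg}_{\ge2}(F)$ is the set of vertices of degree at least $2$. $\mathit{Supp}(F)$ is the set of support vertices, i.e., vertices adjacent to at least one leaf (vertex of degree $1$). *)

theory Defs
  imports Complex_Main "Graph_Theory.Graph_Theory"
begin

text \<open>
  A finite simple graph is a \<^locale>\<open>graph\<close>: a finite symmetric digraph without loops and
  parallel arcs, in which an undirected edge is a pair of opposite arcs. The degree of a vertex
  is therefore its \<^const>\<open>out_degree\<close>.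

  The predicate \<^const>\<open>forest\<close> is meant for digraphs: it also forbids the directed cycle
  of length 2 formed by an arc and its reverse, so a symmetric digraph satisfies it only if it
  has no arcs. In a simple graph the undirected cycles are exactly the directed cycles of length
  at least 3.
\<close>

definition undirected_forest :: "('a, 'b) pre_digraph \<Rightarrow> bool" where
  "undirected_forest F \<longleftrightarrow> graph F \<and> \<not> (\<exists>p. pre_digraph.cycle F p \<and> 3 \<le> length p)"

definition isolated :: "('a, 'b) pre_digraph \<Rightarrow> 'a \<Rightarrow> bool" where
  "isolated F v \<longleftrightarrow> v \<in> verts F \<and> out_degree F v = 0"

definition leaf :: "('a, 'b) pre_digraph \<Rightarrow> 'a \<Rightarrow> bool" where
  "leaf F v \<longleftrightarrow> v \<in> verts F \<and> out_degree F v = 1"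

definition Deg_ge2 :: "('a, 'b) pre_digraph \<Rightarrow> 'a set" where
  "Deg_ge2 F = {v \<in> verts F. 2 \<le> out_degree F v}"

definition Supp :: "('a, 'b) pre_digraph \<Rightarrow> 'a set" where
  "Supp F = {v \<in> verts F. \<exists>u. leaf F u \<and> v \<rightarrow>\<^bsub>F\<^esub> u}"

definition dominating_set :: "('a, 'b) pre_digraph \<Rightarrow> 'a set \<Rightarrow> bool" where
  "dominating_set F D \<longleftrightarrow>
     D \<subseteq> verts F \<and> (\<forall>v \<in> verts F. v \<in> D \<or> (\<exists>u \<in> D. u \<rightarrow>\<^bsub>F\<^esub> v))"

definition domination_number :: "('a, 'b) pre_digraph \<Rightarrow> nat" where
  "domination_number F = Min (card ` {D. dominating_set F D})"

end

theory Submission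
  imports Defs
begin

text \<open>
  Write \<open>S\<^sub>1\<close> for the support vertices of degree 1, that is, the vertices of the components
  \<open>K\<^sub>2\<close>.

  Upper bound: let \<open>B = Deg\<^sub>\<ge>\<^sub>2 \<inter> Supp\<close> and let \<open>R\<close> be the symmetric difference of
  \<open>Deg\<^sub>\<ge>\<^sub>2\<close> and \<open>Supp\<close>. As in Ore's theorem, if \<open>D \<subseteq> R\<close> is minimal such that
  \<open>B \<union> D\<close> dominates, then \<open>B \<union> (R - D)\<close> dominates as well, and the two sizes add up to
  \<open>|Deg\<^sub>\<ge>\<^sub>2| + |Supp|\<close>.

  Lower bound: let \<open>D\<close> be dominating and choose a dominator \<open>c v \<in> D\<close> for each \<open>v \<notin> D\<close>. A
  vertex of degree at least 2 outside \<open>D\<close> has an edge that does not join it to its dominator;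
  since a forest has at most as many edges as vertices, \<open>|Deg\<^sub>\<ge>\<^sub>2 - D| \<le> 2|D|\<close>. Add
  \<open>|Supp - S\<^sub>1| \<le> |D - S\<^sub>1|\<close>, \<open>|Deg\<^sub>\<ge>\<^sub>2 \<inter> D| \<le> |D - S\<^sub>1|\<close> and
  \<open>|S\<^sub>1| \<le> 2|D \<inter> S\<^sub>1|\<close>.
\<close>

section \<open>Edge bound for acyclic symmetric relations\<close>

lemma acyclic_ex_card_neighbours_le_1:
  assumes fin: "finite X" and ne: "X \<noteq> {}" and sym: "sym E" and irr: "irrefl E"
    and acyc: "\<And>xs. distinct xs \<Longrightarrow> 3 \<le> length xs \<Longrightarrow> successively (\<lambda>x y. (x, y) \<in> E) xs
      \<Longrightarrow> (last xs, hd xs) \<notin> E"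
  shows "\<exists>x\<in>X. card (E `` {x} \<inter> X) \<le> 1"
proof (rule ccontr)
  assume "\<not> ?thesis"
  then have two: "2 \<le> card (E `` {x} \<inter> X)" if "x \<in> X" for x
    using that by force
  \<comment> \<open>The first vertex of a longest path has all its neighbours on the path.\<close>
  let ?P = "\<lambda>xs. xs \<noteq> [] \<and> distinct xs \<and> set xs \<subseteq> X \<and> successively (\<lambda>x y. (x, y) \<in> E) xs"
  obtain a where a: "a \<in> X" using ne by auto
  have "length xs < Suc (card X)" if "?P xs" for xs
    using that fin by (metis card_mono distinct_card less_Suc_eq_le)
  moreover have "?P [a]" using a by simp
  ultimately obtain xs where P: "?P xs" and max: "\<And>ys. ?P ys \<Longrightarrow> length ys \<le> length xs"
    using ex_has_greatest_nat[of ?P "[a]" length "Suc (card X)"] by blast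
  obtain x ys where xs: "xs = x # ys" using P by (cases xs) auto
  have nb: "E `` {x} \<inter> X \<subseteq> set ys"
  proof
    fix y assume y: "y \<in> E `` {x} \<inter> X"
    then have "(y, x) \<in> E" "x \<noteq> y" using sym irr by (auto dest: symD simp: irrefl_def)
    moreover have "y \<in> set xs"
    proof (rule ccontr)
      assume "y \<notin> set xs"
      then have "?P (y # xs)" using P y \<open>(y, x) \<in> E\<close> xs by auto
      then show False using max by fastforce
    qed
    ultimately show "y \<in> set ys" using xs by auto
  qed
  have "x \<in> X" using P xs by auto
  then have card2: "2 \<le> card (E `` {x} \<inter> X)" by (rule two)
  then obtain z zs where ys: "ys = z # zs" using nb by (cases ys) auto
  \<comment> \<open>With two neighbours, \<open>x\<close> has one beyond the second vertex
    \<open>z\<close>. The path up to that neighbour has at least three vertices and closes to a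
    cycle.\<close>
  have "\<not> E `` {x} \<inter> X \<subseteq> {z}"
    using card2 card_mono[of "{z}" "E `` {x} \<inter> X"] by auto
  then obtain y where y: "(x, y) \<in> E" "y \<in> set zs" using nb ys by auto
  then obtain us vs where zs: "zs = us @ y # vs" by (meson split_list)
  let ?c = "x # z # us @ [y]"
  have "xs = ?c @ vs" using xs ys zs by simp
  then have "distinct (?c @ vs)" "successively (\<lambda>x y. (x, y) \<in> E) (?c @ vs)"
    using P by metis+
  then have "distinct ?c" "successively (\<lambda>x y. (x, y) \<in> E) ?c"
    unfolding successively_append_iff distinct_append by blast+
  then have "(last ?c, hd ?c) \<notin> E" by (intro acyc) auto
  then show False using y sym by (auto dest: symD)
qed

text \<open>Induction removes a vertex with at most one neighbour, which destroys at most one edge,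
  that is, two ordered pairs.\<close>

lemma acyclic_card_arcs_le:
  assumes fin: "finite X" and sym: "sym E" and irr: "irrefl E"
    and acyc: "\<And>xs. distinct xs \<Longrightarrow> 3 \<le> length xs \<Longrightarrow> successively (\<lambda>x y. (x, y) \<in> E) xs
      \<Longrightarrow> (last xs, hd xs) \<notin> E"
  shows "card (E \<inter> X \<times> X) \<le> 2 * card X"
  using fin
proof (induction rule: finite_remove_induct)
  case empty
  then show ?case by simp
next
  case (remove A)
  obtain x where x: "x \<in> A" "card (E `` {x} \<inter> A) \<le> 1"
    using acyclic_ex_card_neighbours_le_1[OF remove(1,2) sym irr acyc] by blast
  let ?N = "E `` {x} \<inter> A"
  have "E \<inter> A \<times> A \<subseteq> (E \<inter> (A - {x}) \<times> (A - {x})) \<union> (Pair x ` ?N \<union> (\<lambda>y. (y, x)) ` ?N)"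
    using sym by (auto dest: symD)
  then have "card (E \<inter> A \<times> A) \<le> card ((E \<inter> (A - {x}) \<times> (A - {x})) \<union> (Pair x ` ?N \<union> (\<lambda>y. (y, x)) ` ?N))"
    using remove(1) by (intro card_mono) auto
  also have "\<dots> \<le> card (E \<inter> (A - {x}) \<times> (A - {x})) + (card (Pair x ` ?N) + card ((\<lambda>y. (y, x)) ` ?N))"
    using card_Un_le by (meson add_left_mono le_trans)
  also have "\<dots> \<le> 2 * card (A - {x}) + (1 + 1)"
    using remove(4)[OF x(1)] x(2) card_image_le[of ?N] remove(1)
    by (intro add_mono) (auto intro: le_trans)
  also have "\<dots> = 2 * card A"
    using x(1) remove(1) by (metis One_nat_def Suc_1 add_2_eq_Suc' card.remove finite_Diff
        mult_Suc_right one_add_one add.commute)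
  finally show ?case .
qed

section \<open>From vertex lists to arc cycles, and the edge bound for forests\<close>

lemma (in wf_digraph) successively_imp_awalk:
  assumes "xs \<noteq> []" "set xs \<subseteq> verts G" "successively (\<lambda>x y. x \<rightarrow> y) xs"
  shows "\<exists>p. awalk (hd xs) p (last xs) \<and> awalk_verts (hd xs) p = xs"
  using assms
proof (induction xs rule: induct_list012)
  case 1
  then show ?case by simp
next
  case (2 x)
  then show ?case by (auto intro!: exI[of _ "[]"] simp: awalk_Nil_iff)
next
  case (3 x y zs)
  then obtain p where p: "awalk y p (last (y # zs))" "awalk_verts y p = y # zs" by auto
  obtain e where "e \<in> arcs G" "tail G e = x" "head G e = y"
    using 3(5) by (auto simp: arcs_ends_conv)
  then show ?case using p by (auto intro!: exI[of _ "e # p"] simp: awalk_Cons_iff)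
qed

text \<open>Closing a path on k vertices adds one arc to its k - 1 arcs, so the bound 3 on vertices
  in the relational acyclicity matches the bound 3 on arcs in
  \<open>undirected_forest\<close>.\<close>

lemma (in wf_digraph) successively_imp_cycle:
  assumes "distinct xs" "xs \<noteq> []" "successively (\<lambda>x y. x \<rightarrow> y) xs" "last xs \<rightarrow> hd xs"
  shows "\<exists>p. cycle p \<and> length p = length xs"
proof -
  \<comment> \<open>Every entry is the tail of an arc: to its successor, or, for the last entry, to
    \<open>hd xs\<close>.\<close>
  have "set xs \<subseteq> verts G"
  proof
    fix x assume "x \<in> set xs"
    then obtain us vs where xs: "xs = us @ x # vs" by (meson split_list)
    show "x \<in> verts G"
    proof (cases vs)
      case Nil
      then show ?thesis using assms(4) xs by auto
    next
      case (Cons v vs')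
      then show ?thesis using assms(3) xs by (auto simp: successively_append_iff)
    qed
  qed
  then obtain p where p: "awalk (hd xs) p (last xs)" "awalk_verts (hd xs) p = xs"
    using successively_imp_awalk assms by blast
  obtain e where e: "e \<in> arcs G" "tail G e = last xs" "head G e = hd xs"
    using assms(4) by (auto simp: arcs_ends_conv)
  have w: "awalk (hd xs) (p @ [e]) (hd xs)"
    using p e by (auto simp: awalk_Cons_iff awalk_Nil_iff)
  then have "awalk_verts (hd xs) (p @ [e]) = xs @ [hd xs]"
    using p e by (subst awalk_verts_append) auto
  then have "distinct (tl (awalk_verts (hd xs) (p @ [e])))"
    using assms(1,2) by (cases xs) auto
  then have "cycle (p @ [e])" using w unfolding cycle_def by blast
  moreover have "length (p @ [e]) = length xs"
    using p(2) by (metis length_awalk_verts length_append_singleton Suc_eq_plus1)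
  ultimately show ?thesis by blast
qed

lemma undirected_forest_card_arcs_ends_le:
  assumes "undirected_forest F"
  shows "card (arcs_ends F) \<le> 2 * card (verts F)"
proof -
  interpret graph F using assms by (simp add: undirected_forest_def)
  have "arcs_ends F = arcs_ends F \<inter> verts F \<times> verts F" by auto
  also have "card \<dots> \<le> 2 * card (verts F)"
  proof (rule acyclic_card_arcs_le)
    show "sym (arcs_ends F)" using sym_arcs by (simp add: symmetric_def)
    show "irrefl (arcs_ends F)" using no_loops by (force simp: irrefl_def arcs_ends_conv)
    show "(last xs, hd xs) \<notin> arcs_ends F"
      if "distinct xs" "3 \<le> length xs" "successively (\<lambda>x y. (x, y) \<in> arcs_ends F) xs" for xs
      using that successively_imp_cycle[of xs] assms
      by (metis list.size(3) not_numeral_le_zero undirected_forest_def)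
  qed simp
  finally show ?thesis .
qed

lemma (in nomulti_digraph) out_degree_eq_card_neighbours:
  "out_degree G v = card (arcs_ends G `` {v})"
proof -
  have "bij_betw (head G) (out_arcs G v) (arcs_ends G `` {v})"
    unfolding bij_betw_def inj_on_def
    by (force simp: arcs_ends_conv no_multi_arcs arc_to_ends_def intro: no_multi_arcs)
  then show ?thesis unfolding out_degree_def by (rule bij_betw_same_card)
qed

section \<open>Leaves, support vertices and dominating sets\<close>

context graph
begin

lemma sym_adj: "u \<rightarrow> v \<Longrightarrow> v \<rightarrow> u"
  using arcs_ends_symmetric[OF sym_arcs] .

lemma not_adj_self: "\<not> u \<rightarrow> u"
  using no_loops by (force simp: arcs_ends_conv)

lemma finite_neighbours: "finite (arcs_ends G `` {v})"
  by (rule finite_subset[of _ "verts G"]) auto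

lemma leaf_neighbour_unique: "leaf G u \<Longrightarrow> u \<rightarrow> v \<Longrightarrow> u \<rightarrow> w \<Longrightarrow> v = w"
  unfolding leaf_def out_degree_eq_card_neighbours
  by (metis Image_singleton_iff card_1_singletonE singletonD)

lemma Deg_ge2_other_neighbour:
  assumes "u \<in> Deg_ge2 G"
  shows "\<exists>w. u \<rightarrow> w \<and> w \<noteq> v"
proof (rule ccontr)
  assume "\<not> ?thesis"
  then have "arcs_ends G `` {u} \<subseteq> {v}" by auto
  then have "card (arcs_ends G `` {u}) \<le> card {v}" by (intro card_mono) auto
  then show False using assms by (simp add: Deg_ge2_def out_degree_eq_card_neighbours)
qed

lemma adj_imp_leaf_or_Deg_ge2:
  assumes "u \<rightarrow> v"
  shows "leaf G u \<or> u \<in> Deg_ge2 G"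
proof -
  have "out_degree G u \<noteq> 0"
    using assms finite_neighbours[of u] by (auto simp: out_degree_eq_card_neighbours)
  then show ?thesis using assms by (auto simp: leaf_def Deg_ge2_def)
qed

lemma not_leaf_Deg_ge2: "leaf G u \<Longrightarrow> u \<notin> Deg_ge2 G"
  by (simp add: leaf_def Deg_ge2_def)

lemma finite_Deg_ge2 [simp]: "finite (Deg_ge2 G)"
  by (simp add: Deg_ge2_def)

lemma finite_Supp [simp]: "finite (Supp G)"
  by (simp add: Supp_def)

lemma Supp_minus_Deg_ge2_leaf: "v \<in> Supp G - Deg_ge2 G \<Longrightarrow> leaf G v"
  using adj_imp_leaf_or_Deg_ge2 by (auto simp: Supp_def)

text \<open>The only neighbour of the leaf \<open>v\<close> is the leaf that makes \<open>v\<close>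
  a support vertex, so \<open>v\<close> and \<open>w\<close> form a component
  \<open>K\<^sub>2\<close>. Thus \<open>S\<^sub>1\<close> is closed under adjacency.\<close>

lemma Supp_minus_Deg_ge2_neighbour:
  assumes v: "v \<in> Supp G - Deg_ge2 G" and "v \<rightarrow> w"
  shows "w \<in> Supp G - Deg_ge2 G"
proof -
  have "leaf G v" using v by (rule Supp_minus_Deg_ge2_leaf)
  moreover obtain u where "leaf G u" "v \<rightarrow> u" using v by (auto simp: Supp_def)
  ultimately have "leaf G w" using assms(2) leaf_neighbour_unique by blast
  then show ?thesis
    using \<open>leaf G v\<close> sym_adj[OF assms(2)] not_leaf_Deg_ge2 by (auto simp: Supp_def)
qed

lemma finite_dominating_sets: "finite {D. dominating_set G D}"
  by (rule finite_subset[of _ "Pow (verts G)"]) (auto simp: dominating_set_def)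

lemma dominating_set_finite: "dominating_set G D \<Longrightarrow> finite D"
  unfolding dominating_set_def using finite_subset finite_verts by blast

lemma domination_number_le:
  "dominating_set G D \<Longrightarrow> domination_number G \<le> card D"
  unfolding domination_number_def using finite_dominating_sets by (intro Min_le) auto

lemma domination_number_attained:
  "\<exists>D. dominating_set G D \<and> card D = domination_number G"
proof -
  have "dominating_set G (verts G)" by (simp add: dominating_set_def)
  then have "domination_number G \<in> card ` {D. dominating_set G D}"
    unfolding domination_number_def using finite_dominating_sets by (intro Min_in) auto
  then show ?thesis by auto
qed

section \<open>Upper bound by a minimal dominating set and its complement\<close>

lemma domination_number_upper:
  assumes noiso: "\<not> (\<exists>v. isolated G v)"
  shows "2 * domination_number G \<le> card (Deg_ge2 G) + card (Supp G)"
proof -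
  define B where "B = Deg_ge2 G \<inter> Supp G"
  define R where "R = (Deg_ge2 G \<union> Supp G) - B"
  have B: "B \<subseteq> Deg_ge2 G \<union> Supp G" by (auto simp: B_def)
  have verts: "Deg_ge2 G \<union> Supp G \<subseteq> verts G" by (auto simp: Deg_ge2_def Supp_def)
  have nbr: "\<exists>w. v \<rightarrow> w" if "v \<in> verts G" for v
  proof -
    have "arcs_ends G `` {v} \<noteq> {}"
      using noiso that by (metis card.empty isolated_def out_degree_eq_card_neighbours)
    then show ?thesis by auto
  qed
  have all: "dominating_set G (B \<union> R)"
    unfolding dominating_set_def
  proof (intro conjI ballI)
    show "B \<union> R \<subseteq> verts G" using verts B by (auto simp: R_def)
    fix v assume "v \<in> verts G"
    then obtain w where "v \<rightarrow> w" using nbr by blast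
    moreover have "w \<rightarrow> v" using \<open>v \<rightarrow> w\<close> by (rule sym_adj)
    moreover have "w \<in> verts G" using \<open>w \<rightarrow> v\<close> by auto
    ultimately have "v \<in> Deg_ge2 G \<or> w \<in> Supp G \<and> w \<rightarrow> v"
      unfolding Supp_def using adj_imp_leaf_or_Deg_ge2 by blast
    then show "v \<in> B \<union> R \<or> (\<exists>u\<in>B \<union> R. u \<rightarrow> v)" unfolding R_def by blast
  qed
  let ?\<D> = "{D. D \<subseteq> R \<and> dominating_set G (B \<union> D)}"
  have "finite R" by (simp add: R_def)
  have "finite ?\<D>" by (rule finite_subset[of _ "Pow R"]) (use \<open>finite R\<close> in auto)
  moreover have "R \<in> ?\<D>" using all by simp
  ultimately obtain D where D: "D \<in> ?\<D>" and min: "\<And>D'. D' \<in> ?\<D> \<Longrightarrow> D' \<subseteq> D \<Longrightarrow> D' = D"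
    using finite_has_minimal[of ?\<D>] by (metis (no_types, lifting) empty_iff)
  have "dominating_set G (B \<union> (R - D))"
    unfolding dominating_set_def
  proof (intro conjI ballI)
    show "B \<union> (R - D) \<subseteq> verts G" using all by (auto simp: dominating_set_def)
    fix v assume v: "v \<in> verts G"
    show "v \<in> B \<union> (R - D) \<or> (\<exists>u\<in>B \<union> (R - D). u \<rightarrow> v)"
    \<comment> \<open>A vertex outside \<open>B \<union> R\<close> is a leaf outside
      \<open>S\<^sub>1\<close>. Its neighbour is then a support vertex of degree at least 2, so it
      lies in \<open>B\<close> and dominates whatever \<open>D\<close> is.\<close>
    proof (cases "v \<in> B \<union> R")
      case False
      then obtain w where "v \<rightarrow> w" using nbr[OF v] by blast
      have "leaf G v"
        using adj_imp_leaf_or_Deg_ge2[OF \<open>v \<rightarrow> w\<close>] False by (auto simp: R_def)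
      then have "w \<in> Supp G" using sym_adj[OF \<open>v \<rightarrow> w\<close>] by (auto simp: Supp_def)
      have "w \<in> Deg_ge2 G"
        using \<open>w \<in> Supp G\<close> Supp_minus_Deg_ge2_neighbour[OF _ sym_adj[OF \<open>v \<rightarrow> w\<close>]] False
        by (auto simp: R_def B_def)
      then show ?thesis using \<open>w \<in> Supp G\<close> sym_adj[OF \<open>v \<rightarrow> w\<close>] by (auto simp: B_def)
    next
      case True
      show ?thesis
      proof (rule ccontr)
        assume undom: "\<not> ?thesis"
        with True have vD: "v \<in> D" "v \<in> R" "v \<notin> B" by auto
        \<comment> \<open>A neighbour \<open>w\<close> cannot be a leaf outside
          \<open>Supp G\<close>: either \<open>v\<close> is no support vertex and has no leaf
          neighbours, or \<open>v\<close> is in \<open>S\<^sub>1\<close> and so is \<open>w\<close>.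
          As \<open>v\<close> is undominated, \<open>w\<close> is in neither \<open>B\<close> nor
          \<open>R - D\<close>.\<close>
        have nbD: "w \<in> D" if "v \<rightarrow> w" for w
        proof -
          have "w \<in> Deg_ge2 G \<union> Supp G"
          proof (cases "v \<in> Deg_ge2 G")
            case True
            then have "v \<notin> Supp G" using vD by (simp add: B_def)
            then have "\<not> leaf G w" using that v unfolding Supp_def by blast
            then show ?thesis using adj_imp_leaf_or_Deg_ge2[OF sym_adj[OF that]] by blast
          next
            case False
            then have "v \<in> Supp G - Deg_ge2 G" using vD by (simp add: R_def)
            then show ?thesis using Supp_minus_Deg_ge2_neighbour that by blast
          qed
          then show ?thesis using undom sym_adj[OF that] unfolding R_def by blast
        qed
        \<comment> \<open>This contradicts minimality: \<open>v\<close> is dominated by any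
          neighbour, and whatever \<open>v\<close> dominated is itself in \<open>D\<close>.\<close>
        have "dominating_set G (B \<union> (D - {v}))"
          unfolding dominating_set_def
        proof (intro conjI ballI)
          show "B \<union> (D - {v}) \<subseteq> verts G" using D by (auto simp: dominating_set_def)
          fix x assume x: "x \<in> verts G"
          show "x \<in> B \<union> (D - {v}) \<or> (\<exists>u\<in>B \<union> (D - {v}). u \<rightarrow> x)"
          proof (cases "x = v")
            case True
            obtain w where "v \<rightarrow> w" using nbr[OF v] by blast
            moreover have "w \<noteq> v" using \<open>v \<rightarrow> w\<close> not_adj_self by auto
            ultimately show ?thesis using True nbD sym_adj by blast
          next
            case False
            have "x \<in> B \<union> D \<or> (\<exists>u\<in>B \<union> D. u \<rightarrow> x)"
              using D x unfolding dominating_set_def by blast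
            then show ?thesis using False nbD by blast
          qed
        qed
        then have "D - {v} \<in> ?\<D>" using D by auto
        then show False using min[of "D - {v}"] vD by auto
      qed
    qed
  qed
  then have 1: "domination_number G \<le> card (B \<union> (R - D))" by (rule domination_number_le)
  have 2: "domination_number G \<le> card (B \<union> D)" using D domination_number_le by simp
  have "D \<subseteq> R" using D by simp
  have fin: "finite B" "finite D" using \<open>D \<subseteq> R\<close> \<open>finite R\<close> finite_subset by (auto simp: B_def)
  have "card (B \<union> (R - D)) = card B + card (R - D)"
    using fin \<open>finite R\<close> by (intro card_Un_disjoint) (auto simp: R_def)
  moreover have "card (B \<union> D) = card B + card D"
    using fin \<open>D \<subseteq> R\<close> by (intro card_Un_disjoint) (auto simp: R_def)
  moreover have "card R = card (R - D) + card D"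
    using fin \<open>D \<subseteq> R\<close> \<open>finite R\<close> by (simp add: card_Diff_subset card_mono)
  moreover have "card (Deg_ge2 G \<union> Supp G) = card R + card B"
    using B fin by (simp add: R_def card_Diff_subset card_mono)
  moreover have "card (Deg_ge2 G) + card (Supp G) = card (Deg_ge2 G \<union> Supp G) + card B"
    unfolding B_def by (intro card_Un_Int) auto
  ultimately show ?thesis using 1 2 by simp
qed

section \<open>Lower bound by counting against a dominating set\<close>

text \<open>A leaf is dominated only by itself or its support vertex, so \<open>D\<close> contains
  \<open>s\<close> or the chosen leaf \<open>l s\<close>. Neither is in \<open>S\<^sub>1\<close>,
  since \<open>s\<close> has degree at least 2 and \<open>S\<^sub>1\<close> is closed under
  adjacency.\<close>

lemma card_Supp_Int_Deg_ge2_le: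
  assumes D: "dominating_set G D"
  shows "card (Supp G \<inter> Deg_ge2 G) \<le> card (D - (Supp G - Deg_ge2 G))"
proof -
  have "\<forall>s\<in>Supp G. \<exists>u. leaf G u \<and> s \<rightarrow> u" by (auto simp: Supp_def)
  then obtain l where l: "\<And>s. s \<in> Supp G \<Longrightarrow> leaf G (l s)" "\<And>s. s \<in> Supp G \<Longrightarrow> s \<rightarrow> l s"
    by metis
  define f where "f s = (if s \<in> D then s else l s)" for s
  have "inj_on f (Supp G \<inter> Deg_ge2 G)"
  proof (rule inj_onI)
    fix s t assume s: "s \<in> Supp G \<inter> Deg_ge2 G" and t: "t \<in> Supp G \<inter> Deg_ge2 G" and eq: "f s = f t"
    \<comment> \<open>A leaf has one neighbour, so \<open>l\<close> is injective; a mixed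
      coincidence such as \<open>s = l t\<close> would make \<open>s\<close> a leaf.\<close>
    have "s = t" if "l s = l t"
      using leaf_neighbour_unique l sym_adj s t that by (metis IntD1)
    then show "s = t"
      using eq s t l(1) not_leaf_Deg_ge2 by (auto simp: f_def split: if_splits)
  qed
  moreover have "f ` (Supp G \<inter> Deg_ge2 G) \<subseteq> D - (Supp G - Deg_ge2 G)"
  proof
    fix x assume "x \<in> f ` (Supp G \<inter> Deg_ge2 G)"
    then obtain s where s: "s \<in> Supp G" "s \<in> Deg_ge2 G" "x = f s" by auto
    show "x \<in> D - (Supp G - Deg_ge2 G)"
    proof (cases "s \<in> D")
      case True
      then show ?thesis using s by (simp add: f_def)
    next
      case False
      have "l s \<in> verts G" using l s by (auto simp: leaf_def)
      then have "l s \<in> D"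
        using D False l[OF s(1)] leaf_neighbour_unique sym_adj by (metis dominating_set_def)
      moreover have "l s \<notin> Supp G - Deg_ge2 G"
        using Supp_minus_Deg_ge2_neighbour[OF _ sym_adj[OF l(2)[OF s(1)]]] s by auto
      ultimately show ?thesis using s False by (simp add: f_def)
    qed
  qed
  moreover have "finite D" using D by (rule dominating_set_finite)
  ultimately show ?thesis by (intro card_inj_on_le[of f]) auto
qed

text \<open>\<open>D\<close> meets every component \<open>K\<^sub>2\<close>, and \<open>g\<close>
  maps a vertex of such a component to the other one.\<close>

lemma card_Supp_minus_Deg_ge2_le:
  assumes D: "dominating_set G D"
  shows "card (Supp G - Deg_ge2 G) \<le> 2 * card (D \<inter> (Supp G - Deg_ge2 G))"
proof -
  let ?S = "Supp G - Deg_ge2 G"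
  define g where "g u = (SOME w. u \<rightarrow> w)" for u
  have "?S \<subseteq> (D \<inter> ?S) \<union> g ` (D \<inter> ?S)"
  proof
    fix v assume v: "v \<in> ?S"
    show "v \<in> (D \<inter> ?S) \<union> g ` (D \<inter> ?S)"
    proof (cases "v \<in> D")
      case False
      then obtain u where u: "u \<in> D" "u \<rightarrow> v"
        using D v by (auto simp: dominating_set_def Supp_def)
      have uS: "u \<in> ?S" using v sym_adj[OF u(2)] by (rule Supp_minus_Deg_ge2_neighbour)
      have "u \<rightarrow> g u" unfolding g_def using u(2) by (rule someI)
      then have "v = g u"
        using leaf_neighbour_unique[OF Supp_minus_Deg_ge2_leaf[OF uS] u(2)] by simp
      then show ?thesis using u uS by auto
    qed (use v in auto)
  qed
  then have "card ?S \<le> card ((D \<inter> ?S) \<union> g ` (D \<inter> ?S))" by (intro card_mono) auto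
  also have "\<dots> \<le> card (D \<inter> ?S) + card (g ` (D \<inter> ?S))" by (rule card_Un_le)
  also have "\<dots> \<le> card (D \<inter> ?S) + card (D \<inter> ?S)"
    by (intro add_left_mono card_image_le) auto
  finally show ?thesis by simp
qed

text \<open>Both directions of the dominator edges give 2|V - D| arcs, and each vertex of
  \<open>Deg_ge2 G - D\<close> adds one more. At most 2|V| arcs exist, which leaves room for 2|D|
  additional ones.\<close>

lemma card_Deg_ge2_minus_dominating_le:
  assumes D: "dominating_set G D" and arcs: "card (arcs_ends G) \<le> 2 * card (verts G)"
  shows "card (Deg_ge2 G - D) \<le> 2 * card D"
proof -
  let ?U = "Deg_ge2 G - D" and ?C = "verts G - D"
  have "\<forall>v\<in>?C. \<exists>u. u \<in> D \<and> u \<rightarrow> v" using D by (auto simp: dominating_set_def)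
  then obtain c where c: "\<And>v. v \<in> ?C \<Longrightarrow> c v \<in> D" "\<And>v. v \<in> ?C \<Longrightarrow> c v \<rightarrow> v" by metis
  have "\<forall>u\<in>?U. \<exists>w. u \<rightarrow> w \<and> w \<noteq> c u" using Deg_ge2_other_neighbour by auto
  then obtain w where w: "\<And>u. u \<in> ?U \<Longrightarrow> u \<rightarrow> w u" "\<And>u. u \<in> ?U \<Longrightarrow> w u \<noteq> c u" by metis
  have UC: "?U \<subseteq> ?C" by (auto simp: Deg_ge2_def)
  \<comment> \<open>Ordered arcs are counted: an edge \<open>{u, w u}\<close> may arise from both its ends, but yields
    two arcs in that case.\<close>
  define A1 where "A1 = (\<lambda>v. (v, c v)) ` ?C"
  define A2 where "A2 = (\<lambda>v. (c v, v)) ` ?C"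
  define A3 where "A3 = (\<lambda>u. (u, w u)) ` ?U"
  have cards: "card A1 = card ?C" "card A2 = card ?C" "card A3 = card ?U"
    unfolding A1_def A2_def A3_def by (auto intro!: card_image inj_onI)
  have fin: "finite A1" "finite A2" "finite A3" by (auto simp: A1_def A2_def A3_def)
  \<comment> \<open>Arcs of \<open>A2\<close> start in \<open>D\<close>, those of \<open>A1\<close>
    and \<open>A3\<close> outside \<open>D\<close>; \<open>A1\<close> and \<open>A3\<close> are
    separated by \<open>w u \<noteq> c u\<close>.\<close>
  have "A1 \<inter> A2 = {}" "(A1 \<union> A2) \<inter> A3 = {}"
    using c(1) w(2) UC unfolding A1_def A2_def A3_def by auto
  then have "card (A1 \<union> A2 \<union> A3) = card ?C + card ?C + card ?U"
    using fin cards by (simp add: card_Un_disjoint)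
  moreover have "card (A1 \<union> A2 \<union> A3) \<le> card (arcs_ends G)"
  proof (rule card_mono)
    show "finite (arcs_ends G)" by (simp add: arcs_ends_def)
    show "A1 \<union> A2 \<union> A3 \<subseteq> arcs_ends G"
      using c(2) w(1) sym_adj by (auto simp: A1_def A2_def A3_def)
  qed
  moreover have "card ?C + card D = card (verts G)"
    using D dominating_set_finite[OF D]
    by (simp add: dominating_set_def card_Diff_subset card_mono)
  ultimately show ?thesis using arcs by linarith
qed

lemma domination_number_lower:
  assumes "card (arcs_ends G) \<le> 2 * card (verts G)"
  shows "card (Deg_ge2 G) + card (Supp G) \<le> 4 * domination_number G"
proof -
  obtain D where D: "dominating_set G D" "card D = domination_number G"
    using domination_number_attained by blast
  let ?S = "Supp G - Deg_ge2 G"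
  have finD: "finite D" using D(1) by (rule dominating_set_finite)
  have "card (Deg_ge2 G) = card (Deg_ge2 G - D) + card (Deg_ge2 G \<inter> D)"
    by (subst card_Un_disjoint[symmetric]) (auto intro: arg_cong[where f = card])
  moreover have "card (Deg_ge2 G \<inter> D) \<le> card (D - ?S)"
    using finD by (intro card_mono) auto
  moreover have "card (Supp G) = card ?S + card (Supp G \<inter> Deg_ge2 G)"
    by (subst card_Un_disjoint[symmetric]) (auto intro: arg_cong[where f = card])
  moreover have "card D = card (D - ?S) + card (D \<inter> ?S)"
    using finD by (subst card_Un_disjoint[symmetric]) (auto intro: arg_cong[where f = card])
  \<comment> \<open>The four bounds sum to 2|D| + 2|D - \<open>S\<^sub>1\<close>| + 2|D \<inter>
    \<open>S\<^sub>1\<close>| = 4|D|.\<close>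
  ultimately show ?thesis
    using card_Supp_Int_Deg_ge2_le[OF D(1)] card_Supp_minus_Deg_ge2_le[OF D(1)]
      card_Deg_ge2_minus_dominating_le[OF D(1) assms] D(2) by linarith
qed

end

theorem theorem13:
  fixes F :: "('a, 'b) pre_digraph"
  assumes "undirected_forest F"
    and "\<not> (\<exists>v. isolated F v)"
  shows "1 / 4 * (real (card (Deg_ge2 F)) + real (card (Supp F))) \<le> real (domination_number F)
       \<and> real (domination_number F) \<le> 1 / 2 * (real (card (Deg_ge2 F)) + real (card (Supp F)))"
proof -
  interpret graph F using assms(1) by (simp add: undirected_forest_def)
  have "card (Deg_ge2 F) + card (Supp F) \<le> 4 * domination_number F"
    using assms(1) by (intro domination_number_lower undirected_forest_card_arcs_ends_le)
  moreover have "2 * domination_number F \<le> card (Deg_ge2 F) + card (Supp F)"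
    using assms(2) by (rule domination_number_upper)
  ultimately show ?thesis by (simp flip: of_nat_add)
qed

end
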